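(* Let $k$ be a field and let $\Delta$ be a $(d-1)$-dimensional simplicial complex on the vertex set $[n]=\{1,\ldots,n\}$. Then the Hilbert--Samuel multiplicity of its Stanley--Reisner ring satisfies $$e(k[\Delta])=f_{d-1},$$ where $f_{d-1}=f_{d-1}(\Delta)$ is the number of $(d-1)$-dimensional faces of $\Delta$.
   Context: Let $k$ be an arbitrary field and $R=k[x_1,\ldots,x_n]$ with the standard grading. A simplicial complex on $[n]=\{1,\ldots,n\}$ is a set $\Delta$ of subsets of $[n]$, closed under taking subsets, with $\{i\}\in\Delta$ for all $i\in[n]$. Its elements are called faces; the dimension of a face is its cardinality minus one, and $\dim(\Delta)$ is the maximal dimension of a face. The Stanley--Reisner ring is $k[\Delta]=R/I(\Delta)$, where $I(\Delta)=\langle x^F: F\subseteq[n],\ F\notin\Delta\rangle$ and $x^F=\prod_{i\in F}x_i$. For a finitely generated nonnegatively graded $R$-module $M=\bigoplus_{i\ge 0}M_i$, let $h_M(i)=\dim_k M_i$. There is a unique polynomial $P_M(z)\in\mathbb{Q}[z]$ (the Hilbert polynomial) with $h_M(i)=P_M(i)$ for all sufficiently large $i$; it has degree $\dim M-1$, where $\dim M$ is the Krull dimension. The Hilbert--Samuel multiplicity $e(M)$ is $(\dim M-1)!$ times the leading coefficient of $P_M$. *)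

theory Defs
  imports
    "HOL-Library.Poly_Mapping"
    "HOL-Library.Extended_Nat"
    "HOL-Computational_Algebra.Polynomial"
    "HOL-Algebra.QuotRing"
    "HOL-Algebra.Embedded_Algebras"
begin

section \<open>Simplicial complexes\<close>

definition simplicial_complex :: "nat \<Rightarrow> nat set set \<Rightarrow> bool" where
  "simplicial_complex n \<Delta> \<longleftrightarrow>
     \<Delta> \<subseteq> Pow {1..n} \<and> (\<forall>F\<in>\<Delta>. \<forall>G\<subseteq>F. G \<in> \<Delta>) \<and> (\<forall>i\<in>{1..n}. {i} \<in> \<Delta>)"

definition face_dim :: "nat set \<Rightarrow> int" where
  "face_dim F = int (card F) - 1"

text \<open>A relation, since the empty set of faces has no dimension.\<close>

definition has_dimension :: "nat set set \<Rightarrow> int \<Rightarrow> bool" where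
  "has_dimension \<Delta> e \<longleftrightarrow> (\<exists>F\<in>\<Delta>. face_dim F = e) \<and> (\<forall>F\<in>\<Delta>. face_dim F \<le> e)"

definition f_number :: "nat set set \<Rightarrow> int \<Rightarrow> nat" where
  "f_number \<Delta> i = card {F \<in> \<Delta>. face_dim F = i}"


section \<open>The polynomial ring \<open>k[x\<^sub>1, \<dots>, x\<^sub>n]\<close>\<close>

text \<open>
  A monomial is its exponent vector, and a polynomial is a finitely supported coefficient function
  on monomials; multiplication in \<^theory>\<open>HOL-Library.Poly_Mapping\<close> is convolution. The variables of
  the type are indexed by all of \<^typ>\<open>nat\<close>, so that \<open>k[x\<^sub>1, \<dots>, x\<^sub>n]\<close> is a carrier in it.
\<close>

type_synonym 'k mpoly = "(nat \<Rightarrow>\<^sub>0 nat) \<Rightarrow>\<^sub>0 'k"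

definition poly_ring :: "nat \<Rightarrow> 'k::field mpoly ring" where
  "poly_ring n =
     \<lparr>carrier = {p. \<forall>m \<in> Poly_Mapping.keys p. Poly_Mapping.keys m \<subseteq> {1..n}},
      mult = (*), one = 1, zero = 0, add = (+)\<rparr>"

definition const_poly :: "'k::field \<Rightarrow> 'k mpoly" where
  "const_poly c = Poly_Mapping.single 0 c"

definition var :: "nat \<Rightarrow> 'k::field mpoly" where
  "var i = Poly_Mapping.single (Poly_Mapping.single i 1) 1"

definition mono_degree :: "(nat \<Rightarrow>\<^sub>0 nat) \<Rightarrow> nat" where
  "mono_degree m = (\<Sum>i \<in> Poly_Mapping.keys m. Poly_Mapping.lookup m i)"

definition homogeneous_polys :: "nat \<Rightarrow> nat \<Rightarrow> 'k::field mpoly set" where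
  "homogeneous_polys n i =
     {p \<in> carrier (poly_ring n). \<forall>m \<in> Poly_Mapping.keys p. mono_degree m = i}"


section \<open>The Stanley--Reisner ring\<close>

definition face_monomial :: "nat set \<Rightarrow> 'k::field mpoly" where
  "face_monomial F = (\<Prod>i\<in>F. var i)"

definition stanley_reisner_ideal :: "nat \<Rightarrow> nat set set \<Rightarrow> 'k::field mpoly set" where
  "stanley_reisner_ideal n \<Delta> =
     Idl\<^bsub>poly_ring n\<^esub> {face_monomial F | F. F \<subseteq> {1..n} \<and> F \<notin> \<Delta>}"

definition stanley_reisner_ring :: "nat \<Rightarrow> nat set set \<Rightarrow> 'k::field mpoly set ring" where
  "stanley_reisner_ring n \<Delta> = poly_ring n Quot stanley_reisner_ideal n \<Delta>"

text \<open>The image of the field \<open>k\<close> in \<open>k[\<Delta>]\<close>, and the degree \<open>i\<close> component of \<open>k[\<Delta>]\<close>.\<close>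

definition stanley_reisner_scalars :: "nat \<Rightarrow> nat set set \<Rightarrow> 'k::field mpoly set set" where
  "stanley_reisner_scalars n \<Delta> =
     range (\<lambda>c. stanley_reisner_ideal n \<Delta> +>\<^bsub>poly_ring n\<^esub> const_poly c)"

definition stanley_reisner_component ::
    "nat \<Rightarrow> nat set set \<Rightarrow> nat \<Rightarrow> 'k::field mpoly set set" where
  "stanley_reisner_component n \<Delta> i =
     (\<lambda>p. stanley_reisner_ideal n \<Delta> +>\<^bsub>poly_ring n\<^esub> p) ` homogeneous_polys n i"


section \<open>Krull dimension and Hilbert--Samuel multiplicity\<close>

text \<open>The zero ring, which has no prime ideal, gets dimension \<open>0\<close> here.\<close>

definition krull_dim :: "('a, 'b) ring_scheme \<Rightarrow> enat" where
  "krull_dim A = Sup {enat m | m. \<exists>P. (\<forall>i\<le>m. primeideal (P i) A) \<and> (\<forall>i<m. P i \<subset> P (Suc i))}"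

text \<open>
  Below, \<open>A\<close> is a graded quotient of \<open>k[x\<^sub>1, \<dots>, x\<^sub>n]\<close>, \<open>K\<close> is the copy of \<open>k\<close> in \<open>A\<close>, and
  \<open>gr i\<close> is the component of degree \<open>i\<close>. The dimension of \<open>A\<close> as a \<open>k[x\<^sub>1, \<dots>, x\<^sub>n]\<close>-module is its
  dimension as a ring, because the annihilator of \<open>A\<close> is the ideal divided out.
\<close>

definition hilbert_function ::
    "('a, 'b) ring_scheme \<Rightarrow> 'a set \<Rightarrow> (nat \<Rightarrow> 'a set) \<Rightarrow> nat \<Rightarrow> nat" where
  "hilbert_function A K gr i = ring.dim A K (gr i)"

definition hilbert_polynomial ::
    "('a, 'b) ring_scheme \<Rightarrow> 'a set \<Rightarrow> (nat \<Rightarrow> 'a set) \<Rightarrow> rat poly" where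
  "hilbert_polynomial A K gr =
     (THE P. \<forall>\<^sub>F i in sequentially. of_nat (hilbert_function A K gr i) = poly P (of_nat i))"

text \<open>
  The Hilbert polynomial is zero in dimension \<open>0\<close>, where the leading coefficient formula makes no
  sense; there the multiplicity is the length, as usual. For the rings \<open>k[\<Delta>]\<close> this happens only if
  \<open>n = 0\<close> and \<open>\<Delta> = {\<emptyset>}\<close>.
\<close>

definition hilbert_samuel_multiplicity ::
    "('a, 'b) ring_scheme \<Rightarrow> 'a set \<Rightarrow> (nat \<Rightarrow> 'a set) \<Rightarrow> rat" where
  "hilbert_samuel_multiplicity A K gr =
     (if krull_dim A = 0 then of_nat (ring.dim A K (carrier A))
      else fact (the_enat (krull_dim A) - 1) * lead_coeff (hilbert_polynomial A K gr))"

end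

theory Submission
  imports Defs
begin

text \<open>
  The Stanley--Reisner ideal is spanned by the monomials whose support is not a face, so the
  monomials supported on faces form a basis of \<open>k[\<Delta>]\<close>. There are \<open>(i-1 choose |F|-1)\<close> monomials of
  degree \<open>i > 0\<close> with support \<open>F \<noteq> \<emptyset>\<close>; this is a polynomial in \<open>i\<close> of degree \<open>|F| - 1\<close> with leading
  coefficient \<open>1 / (|F| - 1)!\<close>, and only the faces with \<open>|F| = d\<close> contribute in degree \<open>d - 1\<close>.

  The normalizing factorial requires \<open>dim k[\<Delta>] = d\<close>. Elements \<open>f\<^sub>i \<in> P\<^sub>i\<^sub>+\<^sub>1 - P\<^sub>i\<close> chosen along a chain of primes
  are algebraically independent modulo \<open>P\<^sub>0\<close>. If there were \<open>d + 1\<close> of them, the \<open>N ^ (d + 1)\<close> products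
  with exponents below \<open>N\<close> would be linearly independent in a space of dimension \<open>O(N ^ d)\<close>.
  Conversely, for a face with \<open>d\<close> vertices, the primes generated by the variables outside a
  shrinking set of its vertices form a chain of length \<open>d\<close>.
\<close>

section \<open>Polynomials and the Stanley--Reisner ideal\<close>

text \<open>The carrier, the Stanley--Reisner ideal, the graded components and the spaces of
  polynomials with bounded exponents are all spanned by monomials, so each is handled through a set
  of allowed monomials.\<close>

definition polys_on :: "(nat \<Rightarrow>\<^sub>0 nat) set \<Rightarrow> 'k::field mpoly set" where
  "polys_on M = {p. Poly_Mapping.keys p \<subseteq> M}"

definition monos_on :: "nat set \<Rightarrow> (nat \<Rightarrow>\<^sub>0 nat) set" where
  "monos_on F = {m. Poly_Mapping.keys m \<subseteq> F}"

text \<open>Exponents are natural numbers, so nothing cancels; over a general monoid only an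
  inclusion would hold.\<close>

lemma keys_add_nat: "Poly_Mapping.keys (a + b :: nat \<Rightarrow>\<^sub>0 nat) = Poly_Mapping.keys a \<union> Poly_Mapping.keys b"
  by (auto simp: in_keys_iff lookup_add)

lemma monos_on_zero [simp]: "0 \<in> monos_on F"
  by (simp add: monos_on_def)

lemma monos_on_add_iff [simp]: "a + b \<in> monos_on F \<longleftrightarrow> a \<in> monos_on F \<and> b \<in> monos_on F"
  by (auto simp: monos_on_def keys_add_nat)

lemma polys_on_zero [simp]: "0 \<in> polys_on M"
  by (simp add: polys_on_def)

lemma polys_on_single: "m \<in> M \<Longrightarrow> Poly_Mapping.single m c \<in> polys_on M"
  by (simp add: polys_on_def)

lemma polys_on_add: "p \<in> polys_on M \<Longrightarrow> q \<in> polys_on M \<Longrightarrow> p + q \<in> polys_on M"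
  using keys_add[of p q] by (auto simp: polys_on_def)

lemma polys_on_uminus: "p \<in> polys_on M \<Longrightarrow> - p \<in> polys_on M"
  by (auto simp: polys_on_def in_keys_iff)

lemma sum_mem:
  assumes "0 \<in> A" "\<And>x y. x \<in> A \<Longrightarrow> y \<in> A \<Longrightarrow> x + y \<in> A" "\<And>x. x \<in> X \<Longrightarrow> f x \<in> A"
  shows "sum f X \<in> A"
  using assms(3) by (induction X rule: infinite_finite_induct) (auto simp: assms(1,2))

lemma polys_on_sum: "(\<And>x. x \<in> X \<Longrightarrow> f x \<in> polys_on M) \<Longrightarrow> sum f X \<in> polys_on M"
  by (rule sum_mem) (auto intro: polys_on_add)

text \<open>Three separate sets are allowed so that one lemma covers subrings, absorption by
  monomial ideals and the addition of exponent bounds.\<close>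

lemma polys_on_mult:
  assumes "p \<in> polys_on M" "q \<in> polys_on N" "\<And>a b. a \<in> M \<Longrightarrow> b \<in> N \<Longrightarrow> a + b \<in> L"
  shows "p * q \<in> polys_on L"
  using keys_mult[of p q] assms unfolding polys_on_def by blast

lemma polys_on_monos_on_mult:
  "p \<in> polys_on (monos_on F) \<Longrightarrow> q \<in> polys_on (monos_on F) \<Longrightarrow> p * q \<in> polys_on (monos_on F)"
  by (erule polys_on_mult) auto

lemma carrier_poly_ring: "carrier (poly_ring n) = polys_on (monos_on {1..n})"
  by (auto simp: poly_ring_def polys_on_def monos_on_def)

lemma poly_ring_simps [simp]:
  "mult (poly_ring n) = (*)" "one (poly_ring n) = 1"
  "zero (poly_ring n) = 0" "add (poly_ring n) = (+)"
  by (simp_all add: poly_ring_def)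

lemma one_in_polys_on: "0 \<in> M \<Longrightarrow> 1 \<in> polys_on M"
  by (simp add: polys_on_def)

section \<open>The ring structure of \<open>poly_ring n\<close> and its constants\<close>

lemma cring_poly_ring: "cring (poly_ring n :: 'k::field mpoly ring)"
proof (rule cringI)
  show "abelian_group (poly_ring n :: 'k mpoly ring)"
  proof (rule abelian_groupI)
    fix x :: "'k mpoly" assume "x \<in> carrier (poly_ring n)"
    then show "\<exists>y\<in>carrier (poly_ring n). y \<oplus>\<^bsub>poly_ring n\<^esub> x = \<zero>\<^bsub>poly_ring n\<^esub>"
      by (intro bexI[of _ "- x"]) (auto simp: carrier_poly_ring polys_on_uminus)
  qed (auto simp: carrier_poly_ring polys_on_add algebra_simps)
  show "Group.comm_monoid (poly_ring n :: 'k mpoly ring)"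
    by (rule comm_monoidI)
      (auto simp: carrier_poly_ring polys_on_monos_on_mult algebra_simps one_in_polys_on)
qed (auto simp: algebra_simps)

lemma a_inv_poly_ring: "x \<in> carrier (poly_ring n) \<Longrightarrow> \<ominus>\<^bsub>poly_ring n\<^esub> x = - x"
  using cring_poly_ring[of n]
  by (intro abelian_group.minus_equality) (auto simp: cring_def ring_def carrier_poly_ring polys_on_uminus)

lemma a_minus_poly_ring:
  "y \<in> carrier (poly_ring n) \<Longrightarrow> x \<ominus>\<^bsub>poly_ring n\<^esub> y = x - y"
  by (simp add: a_minus_def a_inv_poly_ring)

lemma poly_as_sum: "p = (\<Sum>m\<in>Poly_Mapping.keys p. Poly_Mapping.single m (Poly_Mapping.lookup p m))"
  by (rule poly_mapping_eqI) (auto simp: lookup_sum lookup_single when_def in_keys_iff)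

lemma lookup_const_mult:
  "Poly_Mapping.lookup (const_poly c * p) m = c * Poly_Mapping.lookup p m"
  unfolding const_poly_def mult_map_scale_conv_mult[symmetric] by (simp add: map.rep_eq when_def)

lemma const_mult_in_polys_on: "p \<in> polys_on M \<Longrightarrow> const_poly c * p \<in> polys_on M"
  by (auto simp: polys_on_def in_keys_iff lookup_const_mult)

lemma const_poly_simps:
  "const_poly 0 = 0" "const_poly 1 = 1"
  "const_poly (a + b) = const_poly a + const_poly b" "const_poly (a * b) = const_poly a * const_poly b"
  "const_poly (- a) = - const_poly a"
  by (simp_all add: const_poly_def single_add mult_single single_uminus)

text \<open>For \<open>monos_on F\<close> this sets the variables outside F to zero; for
  \<open>face_monos \<Delta>\<close> it is the normal form modulo the Stanley--Reisner
  ideal.\<close>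

definition restrict_poly :: "(nat \<Rightarrow>\<^sub>0 nat) set \<Rightarrow> 'k::field mpoly \<Rightarrow> 'k mpoly" where
  "restrict_poly M p = Poly_Mapping.mapp (\<lambda>m c. if m \<in> M then c else 0) p"

lemma lookup_restrict_poly:
  "Poly_Mapping.lookup (restrict_poly M p) m = (if m \<in> M then Poly_Mapping.lookup p m else 0)"
  by (auto simp: restrict_poly_def lookup_mapp when_def in_keys_iff)

lemma restrict_poly_add: "restrict_poly M (p + q) = restrict_poly M p + restrict_poly M q"
  by (rule poly_mapping_eqI) (simp add: lookup_restrict_poly lookup_add)

lemma keys_restrict_poly: "Poly_Mapping.keys (restrict_poly M p) = Poly_Mapping.keys p \<inter> M"
  by (auto simp: in_keys_iff lookup_restrict_poly split: if_splits)

lemma restrict_poly_eq_0_iff: "restrict_poly M p = 0 \<longleftrightarrow> p \<in> polys_on (- M)"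
  using keys_restrict_poly[of M p] by (auto simp: polys_on_def keys_eq_empty[symmetric] simp del: keys_eq_empty)

lemma restrict_poly_id: "p \<in> polys_on M \<Longrightarrow> restrict_poly M p = p"
  by (rule poly_mapping_eqI) (auto simp: lookup_restrict_poly polys_on_def in_keys_iff)

lemma diff_restrict_poly: "p - restrict_poly M p \<in> polys_on (- M)"
  by (auto simp: polys_on_def in_keys_iff lookup_restrict_poly lookup_minus split: if_splits)

text \<open>The monomials outside \<open>monos_on F\<close> absorb multiplication, so both error
  terms restrict to zero, while \<open>monos_on F\<close> itself is closed under products. This is
  what makes the vertex ideals prime later on.\<close>

lemma restrict_poly_mult:
  fixes p q :: "'k::field mpoly"
  shows "restrict_poly (monos_on F) (p * q) = restrict_poly (monos_on F) p * restrict_poly (monos_on F) q"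
proof -
  define r :: "'k mpoly \<Rightarrow> 'k mpoly" where "r = restrict_poly (monos_on F)"
  have r: "r p \<in> polys_on (monos_on F)" for p
    by (simp add: r_def polys_on_def keys_restrict_poly)
  have "(p - r p) * q \<in> polys_on (- monos_on F)"
    by (rule polys_on_mult[of _ "- monos_on F" _ UNIV]) (auto simp: r_def diff_restrict_poly polys_on_def[of UNIV])
  moreover have "r p * (q - r q) \<in> polys_on (- monos_on F)"
    by (rule polys_on_mult[of _ UNIV _ "- monos_on F"]) (auto simp: r_def diff_restrict_poly polys_on_def[of UNIV])
  ultimately have "r ((p - r p) * q) = 0" "r (r p * (q - r q)) = 0"
    by (simp_all add: r_def restrict_poly_eq_0_iff)
  moreover have "p * q = r p * r q + ((p - r p) * q + r p * (q - r q))"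
    by (simp add: algebra_simps)
  then have "r (p * q) = r (r p * r q) + (r ((p - r p) * q) + r (r p * (q - r q)))"
    by (metis r_def restrict_poly_add)
  moreover have "r (r p * r q) = r p * r q"
    using restrict_poly_id[OF polys_on_monos_on_mult[OF r r]] r_def by simp
  ultimately show ?thesis by (simp add: r_def)
qed

section \<open>Squarefree monomials and the generators of the ideal\<close>

definition face_exponent :: "nat set \<Rightarrow> nat \<Rightarrow>\<^sub>0 nat" where
  "face_exponent F = (\<Sum>i\<in>F. Poly_Mapping.single i 1)"

lemma face_monomial_eq:
  "finite F \<Longrightarrow> face_monomial F = Poly_Mapping.single (face_exponent F) 1"
  unfolding face_monomial_def face_exponent_def
  by (induction rule: finite_induct) (simp_all add: var_def mult_single)

lemma lookup_face_exponent:
  "finite F \<Longrightarrow> Poly_Mapping.lookup (face_exponent F) j = (if j \<in> F then 1 else 0)"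
  by (simp add: face_exponent_def lookup_sum lookup_single when_def)

lemma keys_face_exponent: "finite F \<Longrightarrow> Poly_Mapping.keys (face_exponent F) = F"
  by (auto simp: in_keys_iff lookup_face_exponent split: if_splits)

definition face_monos :: "nat set set \<Rightarrow> (nat \<Rightarrow>\<^sub>0 nat) set" where
  "face_monos \<Delta> = {m. Poly_Mapping.keys m \<in> \<Delta>}"

text \<open>Enlarging a non-face gives a non-face, so the span of the non-face monomials is an ideal
  containing the generators. Conversely, each such monomial is a multiple of the squarefree monomial
  of its own support.\<close>

lemma stanley_reisner_ideal_eq:
  assumes "simplicial_complex n \<Delta>"
  shows "stanley_reisner_ideal n \<Delta> = (polys_on (monos_on {1..n} - face_monos \<Delta>) :: 'k::field mpoly set)"
    (is "?I = ?J")
proof -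
  let ?R = "poly_ring n :: 'k mpoly ring"
  let ?G = "{face_monomial F | F. F \<subseteq> {1..n} \<and> F \<notin> \<Delta>} :: 'k mpoly set"
  interpret cring ?R by (rule cring_poly_ring)
  have sub: "G \<in> \<Delta>" if "F \<in> \<Delta>" "G \<subseteq> F" for F G
    using assms that unfolding simplicial_complex_def by blast
  have fin: "finite F" if "F \<subseteq> {1..n}" for F
    using that finite_subset by blast
  have gen: "?G \<subseteq> ?J"
    by (auto simp: face_monomial_eq fin face_monos_def keys_face_exponent monos_on_def
        simp del: One_nat_def intro!: polys_on_single) (meson atLeastAtMost_iff subsetD)+
  have JR: "?J \<subseteq> carrier ?R" unfolding carrier_poly_ring by (auto simp: polys_on_def)
  have absorb: "p * q \<in> ?J" if "p \<in> ?J" "q \<in> carrier ?R" for p q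
    using that by (intro polys_on_mult[of p _ q])
      (auto simp: carrier_poly_ring face_monos_def keys_add_nat intro: sub)
  have "ideal ?J ?R"
  proof (rule idealI)
    show "subgroup ?J (add_monoid ?R)"
    proof (rule add.subgroupI)
      show "?J \<noteq> {}" using polys_on_zero by blast
      fix x :: "'k mpoly" assume "x \<in> ?J"
      then show "\<ominus>\<^bsub>?R\<^esub> x \<in> ?J" using JR by (auto simp: a_inv_poly_ring subsetD polys_on_uminus)
    qed (use JR in \<open>auto simp: polys_on_add\<close>)
    show "ring ?R" by (rule ring_axioms)
  qed (use absorb in \<open>auto simp: mult.commute\<close>)
  then have "?I \<subseteq> ?J"
    unfolding stanley_reisner_ideal_def using gen by (rule genideal_minimal)
  moreover have "p \<in> ?I" if "p \<in> ?J" for p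
  proof -
    interpret I: ideal ?I ?R
      unfolding stanley_reisner_ideal_def by (rule genideal_ideal) (use gen JR in blast)
    have zero: "0 \<in> ?I" using I.zero_closed by simp
    have add: "a + b \<in> ?I" if "a \<in> ?I" "b \<in> ?I" for a b using I.a_closed[OF that] by simp
    have "Poly_Mapping.single m c \<in> ?I" if m: "m \<in> monos_on {1..n} - face_monos \<Delta>" for m c
    proof -
      let ?F = "Poly_Mapping.keys m"
      let ?e = "face_exponent ?F"
      have "?F \<subseteq> {1..n}" "?F \<notin> \<Delta>" using m by (auto simp: monos_on_def face_monos_def)
      then have "face_monomial ?F \<in> ?I"
        unfolding stanley_reisner_ideal_def using genideal_self[of ?G] gen JR by blast
      moreover have "Poly_Mapping.single (m - ?e) c \<in> carrier ?R"
        using \<open>?F \<subseteq> {1..n}\<close> unfolding carrier_poly_ring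
        by (intro polys_on_single) (auto simp: monos_on_def in_keys_iff lookup_minus)
      ultimately have "Poly_Mapping.single (m - ?e) c * face_monomial ?F \<in> ?I"
        using I.I_l_closed by simp
      \<comment> \<open>Truncated subtraction is harmless: every exponent of m on its support is at
        least 1.\<close>
      moreover have "m - ?e + ?e = m"
        by (rule poly_mapping_eqI)
          (auto simp: lookup_add lookup_minus lookup_face_exponent in_keys_iff simp del: One_nat_def)
      ultimately show ?thesis by (simp add: face_monomial_eq mult_single)
    qed
    then have "(\<Sum>m\<in>Poly_Mapping.keys p. Poly_Mapping.single m (Poly_Mapping.lookup p m)) \<in> ?I"
      using that unfolding polys_on_def
      by (intro sum_mem) (auto simp: zero add)
    then show ?thesis using poly_as_sum[of p] by simp
  qed
  ultimately show ?thesis by blast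
qed

section \<open>The monomial basis\<close>

text \<open>\<open>ring.dim\<close> is taken over a subfield of the ring, so k must first be
  realised inside the polynomial ring.\<close>

lemma subfield_const_poly: "subfield (range const_poly) (poly_ring n :: 'k::field mpoly ring)"
proof -
  let ?R = "poly_ring n :: 'k mpoly ring"
  interpret cring ?R by (rule cring_poly_ring)
  have carr: "range const_poly \<subseteq> carrier ?R"
    by (auto simp: carrier_poly_ring const_poly_def intro: polys_on_single)
  have "subring (range const_poly) ?R"
    by (rule subringI)
      (use carr in \<open>auto simp: a_inv_poly_ring image_subset_iff const_poly_simps[symmetric]\<close>)
  moreover have "Units (?R\<lparr>carrier := range const_poly\<rparr>) = range const_poly - {0}"
  proof (intro equalityI subsetI)
    fix x :: "'k mpoly" assume x: "x \<in> range const_poly - {0}"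
    then obtain c where "x = const_poly c" by blast
    with x have c: "x = const_poly c" "c \<noteq> 0" using const_poly_simps(1) by auto
    then have "const_poly (inverse c) * const_poly c = 1"
      by (simp add: const_poly_simps[symmetric])
    then show "x \<in> Units (?R\<lparr>carrier := range const_poly\<rparr>)"
      using c by (auto simp: Units_def mult.commute)
  qed (auto simp: Units_def)
  ultimately show ?thesis
    by (intro subfieldI) (use carr in \<open>auto simp: image_subset_iff intro!: subcringI m_comm\<close>)
qed

text \<open>The parameter \<open>base\<close> fixes the coefficient field, whose type does not occur
  in \<open>n\<close> or \<open>\<Delta>\<close>.\<close>

locale stanley_reisner =
  fixes n :: nat and \<Delta> :: "nat set set" and base :: "'k::field itself"
  assumes complex: "simplicial_complex n \<Delta>"
begin

abbreviation R :: "'k mpoly ring" where "R \<equiv> poly_ring n"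
abbreviation I :: "'k mpoly set" where "I \<equiv> stanley_reisner_ideal n \<Delta>"
abbreviation A :: "'k mpoly set ring" where "A \<equiv> stanley_reisner_ring n \<Delta>"
abbreviation proj :: "'k mpoly \<Rightarrow> 'k mpoly set" where "proj p \<equiv> I +>\<^bsub>R\<^esub> p"

lemma I_eq: "I = polys_on (monos_on {1..n} - face_monos \<Delta>)"
  by (rule stanley_reisner_ideal_eq[OF complex])

lemma mem_I_iff: "p \<in> carrier R \<Longrightarrow> p \<in> I \<longleftrightarrow> restrict_poly (face_monos \<Delta>) p = 0"
  by (auto simp: restrict_poly_eq_0_iff I_eq carrier_poly_ring polys_on_def)

lemma subset_faces: "F \<in> \<Delta> \<Longrightarrow> G \<subseteq> F \<Longrightarrow> G \<in> \<Delta>"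
  and faces_subset: "F \<in> \<Delta> \<Longrightarrow> F \<subseteq> {1..n}"
  using complex unfolding simplicial_complex_def by blast+

lemma finite_face: "F \<in> \<Delta> \<Longrightarrow> finite F"
  using faces_subset finite_subset by blast

lemma finite_complex: "finite \<Delta>"
  using faces_subset by (intro finite_subset[of \<Delta> "Pow {1..n}"]) auto

lemma face_monos_subset: "face_monos \<Delta> \<subseteq> monos_on {1..n}"
  using faces_subset by (auto simp: face_monos_def monos_on_def)

lemma cring_R: "cring R" by (rule cring_poly_ring)

lemma ideal_I: "ideal I R"
proof -
  interpret cring R by (rule cring_R)
  have "finite F" if "F \<subseteq> {1..n}" for F using that finite_subset by blast
  then have "face_monomial F \<in> carrier R" if "F \<subseteq> {1..n}" for F
    using that unfolding carrier_poly_ring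
    by (simp add: face_monomial_eq polys_on_single monos_on_def keys_face_exponent)
  then show ?thesis
    unfolding stanley_reisner_ideal_def by (intro genideal_ideal) auto
qed

lemma cring_A: "cring A"
  unfolding stanley_reisner_ring_def using ideal.quotient_is_cring[OF ideal_I cring_R] .

lemma proj_hom: "ring_hom_ring R A proj"
  unfolding stanley_reisner_ring_def using ideal.rcos_ring_hom_ring[OF ideal_I] .

lemma carrier_A: "carrier A = proj ` carrier R"
  by (auto simp: stanley_reisner_ring_def FactRing_def A_RCOSETS_def')

lemma proj_eq_iff: "p \<in> carrier R \<Longrightarrow> q \<in> carrier R \<Longrightarrow> proj p = proj q \<longleftrightarrow> p - q \<in> I"
  using ring.quotient_eq_iff_same_a_r_cos[OF cring.axioms(1)[OF cring_R] ideal_I, of p q]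
  by (simp add: a_minus_poly_ring)

lemma proj_eq_0_iff: "p \<in> carrier R \<Longrightarrow> proj p = \<zero>\<^bsub>A\<^esub> \<longleftrightarrow> p \<in> I"
proof -
  interpret proj: ring_hom_ring R A proj by (rule proj_hom)
  show "p \<in> carrier R \<Longrightarrow> ?thesis"
    using proj_eq_iff[of p 0] proj.hom_zero by (simp add: carrier_poly_ring)
qed

lemma const_in_carrier: "const_poly c \<in> carrier R"
  by (simp add: carrier_poly_ring const_poly_def polys_on_single)

lemma empty_face: "\<Delta> \<noteq> {} \<Longrightarrow> {} \<in> \<Delta>"
  using subset_faces by blast

text \<open>The image of a subfield is a subfield once the target is not the zero ring. Here 1
  survives because its monomial is supported on the empty face.\<close>

lemma subfield_scalars:
  assumes "\<Delta> \<noteq> {}"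
  shows "subfield (stanley_reisner_scalars n \<Delta>) A"
proof -
  have "(1 :: 'k mpoly) \<notin> I"
    using empty_face[OF assms] by (simp add: I_eq polys_on_def face_monos_def)
  then have "\<one>\<^bsub>A\<^esub> \<noteq> \<zero>\<^bsub>A\<^esub>"
    using proj_eq_0_iff[of 1] const_in_carrier[of 1] ring_hom_one[OF ring_hom_ring.homh[OF proj_hom]]
    by (simp add: const_poly_simps)
  moreover have "stanley_reisner_scalars n \<Delta> = proj ` range const_poly"
    by (auto simp: stanley_reisner_scalars_def)
  ultimately show ?thesis
    using ring_hom_ring.img_is_subfield(2)[OF proj_hom subfield_const_poly] by simp
qed

text \<open>Monomials are added one at a time: a face monomial extends the image by a line, any
  other is already zero in the quotient. A general finite S serves both for the graded components
  and for the whole ring in dimension 0.\<close>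

lemma dim_proj_polys_on:
  assumes "\<Delta> \<noteq> {}" and "finite S" and "S \<subseteq> monos_on {1..n}"
  shows "ring.dim A (stanley_reisner_scalars n \<Delta>) (proj ` polys_on S) = card (S \<inter> face_monos \<Delta>)"
proof -
  interpret A: cring A by (rule cring_A)
  interpret proj: ring_hom_ring R A proj by (rule proj_hom)
  let ?K = "stanley_reisner_scalars n \<Delta> :: 'k mpoly set set"
  have "A.dimension (card (S \<inter> face_monos \<Delta>)) ?K (proj ` polys_on S)"
    using assms(2,3)
  proof (induction S rule: finite_induct)
    case empty
    have "polys_on {} = {0 :: 'k mpoly}" by (auto simp: polys_on_def)
    then show ?case using A.zero_dim[of ?K] proj.hom_zero by simp
  next
    case (insert m S)
    have SR: "polys_on S \<subseteq> carrier R" "polys_on (insert m S) \<subseteq> carrier R"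
      using insert.prems by (auto simp: carrier_poly_ring polys_on_def)
    have mR: "Poly_Mapping.single m c \<in> carrier R" for c :: 'k
      using insert.prems by (auto simp: carrier_poly_ring intro: polys_on_single)
    have split: "p - Poly_Mapping.single m (Poly_Mapping.lookup p m) \<in> polys_on S"
      if "p \<in> polys_on (insert m S)" for p :: "'k mpoly"
      using that by (auto simp: polys_on_def in_keys_iff lookup_minus lookup_single when_def split: if_splits)
    show ?case
    proof (cases "m \<in> face_monos \<Delta>")
      case True
      let ?x = "Poly_Mapping.single m (1::'k)"
      \<comment> \<open>A polynomial on S has coefficient 0 at m, so the difference keeps
        coefficient 1 at a face monomial and cannot lie in \<open>I\<close>.\<close>
      have "proj ?x \<notin> proj ` polys_on S"
      proof
        assume "proj ?x \<in> proj ` polys_on S"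
        then obtain q :: "'k mpoly" where q: "q \<in> polys_on S" "proj ?x = proj q" by blast
        then have "?x - q \<in> I" using proj_eq_iff mR SR by blast
        moreover have "Poly_Mapping.lookup (?x - q) m = 1"
          using q(1) insert.hyps by (auto simp: polys_on_def in_keys_iff lookup_minus)
        then have "m \<in> Poly_Mapping.keys (?x - q)" by (simp add: in_keys_iff)
        ultimately show False using True by (auto simp: I_eq polys_on_def)
      qed
      moreover have "proj ?x \<in> carrier A" using mR by (rule proj.hom_closed)
      moreover have "proj ` polys_on (insert m S) = A.line_extension ?K (proj ?x) (proj ` polys_on S)"
      proof -
        have scale: "proj (const_poly c) \<otimes>\<^bsub>A\<^esub> proj ?x \<oplus>\<^bsub>A\<^esub> proj q
            = proj (Poly_Mapping.single m c + q)" if "q \<in> polys_on S" for c and q :: "'k mpoly"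
        proof -
          have "proj (const_poly c) \<otimes>\<^bsub>A\<^esub> proj ?x = proj (const_poly c * ?x)"
            using proj.hom_mult[OF const_in_carrier mR] by simp
          moreover have "const_poly c * ?x = Poly_Mapping.single m c"
            by (simp add: const_poly_def mult_single)
          ultimately show ?thesis using proj.hom_add[OF mR, of q c] that SR by auto
        qed
        show ?thesis
        proof (intro equalityI subsetI)
          fix X assume "X \<in> proj ` polys_on (insert m S)"
          then obtain p :: "'k mpoly" where p: "p \<in> polys_on (insert m S)" "X = proj p" by blast
          let ?c = "Poly_Mapping.lookup p m"
          have "X = proj (const_poly ?c) \<otimes>\<^bsub>A\<^esub> proj ?x \<oplus>\<^bsub>A\<^esub> proj (p - Poly_Mapping.single m ?c)"
            using scale[OF split[OF p(1)], of ?c] p by simp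
          then show "X \<in> A.line_extension ?K (proj ?x) (proj ` polys_on S)"
            using split[OF p(1)]
            unfolding A.line_extension_mem_iff stanley_reisner_scalars_def by blast
        next
          fix X assume "X \<in> A.line_extension ?K (proj ?x) (proj ` polys_on S)"
          then obtain c and q :: "'k mpoly" where "q \<in> polys_on S"
            "X = proj (const_poly c) \<otimes>\<^bsub>A\<^esub> proj ?x \<oplus>\<^bsub>A\<^esub> proj q"
            unfolding A.line_extension_mem_iff stanley_reisner_scalars_def by blast
          moreover from this have "Poly_Mapping.single m c + q \<in> polys_on (insert m S)"
            by (intro polys_on_add polys_on_single) (auto simp: polys_on_def)
          ultimately show "X \<in> proj ` polys_on (insert m S)" using scale by auto
        qed
      qed
      ultimately show ?thesis
        using A.Suc_dim[of "proj ?x" "proj ` polys_on S"] insert True by simp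
    next
      case False
      have "proj ` polys_on S \<subseteq> proj ` polys_on (insert m S)"
        by (intro image_mono) (auto simp: polys_on_def)
      moreover have "proj ` polys_on (insert m S) \<subseteq> proj ` polys_on S"
      proof
        fix X assume "X \<in> proj ` polys_on (insert m S)"
        then obtain p :: "'k mpoly" where p: "p \<in> polys_on (insert m S)" "X = proj p" by blast
        let ?q = "p - Poly_Mapping.single m (Poly_Mapping.lookup p m)"
        \<comment> \<open>The discarded term is a multiple of a non-face monomial, so dropping it
          does not change the residue class.\<close>
        have "p - ?q \<in> I"
          using False insert.prems by (auto simp: I_eq intro: polys_on_single)
        then have "X = proj ?q"
          using proj_eq_iff[of p ?q] split[OF p(1)] p SR by blast
        then show "X \<in> proj ` polys_on S" using split[OF p(1)] by blast
      qed
      ultimately have "proj ` polys_on (insert m S) = proj ` polys_on S" by (rule equalityI[rotated])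
      then show ?thesis using insert False by simp
    qed
  qed
  then show ?thesis using A.dimI[OF subfield_scalars[OF assms(1)]] by (simp add: over_def)
qed

end

section \<open>The Hilbert polynomial\<close>

lemma mono_degree_superset:
  "finite F \<Longrightarrow> Poly_Mapping.keys m \<subseteq> F \<Longrightarrow> mono_degree m = (\<Sum>i\<in>F. Poly_Mapping.lookup m i)"
  unfolding mono_degree_def by (rule sum.mono_neutral_left) (auto simp: in_keys_iff)

lemma mono_degree_add: "mono_degree (a + b) = mono_degree a + mono_degree b"
proof -
  let ?F = "Poly_Mapping.keys a \<union> Poly_Mapping.keys b"
  have "mono_degree (a + b) = (\<Sum>i\<in>?F. Poly_Mapping.lookup (a + b) i)"
    by (rule mono_degree_superset) (auto simp: keys_add_nat)
  also have "\<dots> = mono_degree a + mono_degree b"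
    by (simp add: lookup_add sum.distrib mono_degree_superset[of ?F])
  finally show ?thesis .
qed

lemma mono_degree_eq_0_iff: "mono_degree m = 0 \<longleftrightarrow> m = 0"
  by (auto simp: mono_degree_def in_keys_iff intro!: poly_mapping_eqI)

lemma mono_degree_single: "mono_degree (Poly_Mapping.single i k) = k"
  by (simp add: mono_degree_def)

section \<open>Counting monomials by support and degree\<close>

definition monos_of :: "nat set \<Rightarrow> nat \<Rightarrow> (nat \<Rightarrow>\<^sub>0 nat) set" where
  "monos_of F i = {m. Poly_Mapping.keys m = F \<and> mono_degree m = i}"

lemma monos_of_empty: "monos_of {} i = (if i = 0 then {0} else {})"
  by (auto simp: monos_of_def mono_degree_eq_0_iff mono_degree_def)

lemma monos_of_0: "F \<noteq> {} \<Longrightarrow> monos_of F 0 = {}"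
  by (auto simp: monos_of_def mono_degree_eq_0_iff)

text \<open>Divide by the variable of index a once: its exponent either becomes 0, leaving support
  F, or stays positive. This gives a Pascal recursion.\<close>

lemma monos_of_insert_Suc:
  assumes "a \<notin> F"
  shows "monos_of (insert a F) (Suc i) =
    (\<lambda>m. m + Poly_Mapping.single a 1) ` (monos_of F i \<union> monos_of (insert a F) i)"
proof (intro equalityI subsetI)
  fix m assume m: "m \<in> monos_of (insert a F) (Suc i)"
  let ?m = "m - Poly_Mapping.single a 1"
  have "Poly_Mapping.lookup m a > 0"
    using m by (auto simp: monos_of_def in_keys_iff)
  then have eq: "m = ?m + Poly_Mapping.single a 1"
    by (intro poly_mapping_eqI) (auto simp: lookup_add lookup_minus lookup_single when_def)
  have "Poly_Mapping.keys ?m - {a} = Poly_Mapping.keys m - {a}"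
    by (auto simp: in_keys_iff lookup_minus lookup_single when_def split: if_splits)
  then have "Poly_Mapping.keys ?m = F \<or> Poly_Mapping.keys ?m = insert a F"
    using m assms unfolding monos_of_def by blast
  moreover have "mono_degree ?m = i"
    using m arg_cong[OF eq, of mono_degree] by (simp add: mono_degree_add mono_degree_single monos_of_def)
  ultimately show "m \<in> (\<lambda>m. m + Poly_Mapping.single a 1) ` (monos_of F i \<union> monos_of (insert a F) i)"
    using eq unfolding monos_of_def by blast
next
  fix m assume "m \<in> (\<lambda>m. m + Poly_Mapping.single a 1) ` (monos_of F i \<union> monos_of (insert a F) i)"
  then obtain m' where m': "m = m' + Poly_Mapping.single a 1" "m' \<in> monos_of F i \<union> monos_of (insert a F) i"
    by blast
  then have "Poly_Mapping.keys m = insert a F"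
    unfolding m'(1) keys_add_nat by (auto simp: monos_of_def)
  moreover have "mono_degree m = Suc i"
    using m' by (auto simp: monos_of_def mono_degree_add mono_degree_single)
  ultimately show "m \<in> monos_of (insert a F) (Suc i)" by (simp add: monos_of_def)
qed

lemma finite_monos_of: "finite F \<Longrightarrow> finite (monos_of F i)"
proof (induction F arbitrary: i rule: finite_induct)
  case (insert a F)
  show ?case
  proof (induction i)
    case (Suc i)
    then show ?case using insert by (simp add: monos_of_insert_Suc)
  qed (simp add: monos_of_0)
qed (simp add: monos_of_empty)

lemma card_monos_of_insert_Suc:
  assumes "a \<notin> F" "finite F"
  shows "card (monos_of (insert a F) (Suc i)) = card (monos_of F i) + card (monos_of (insert a F) i)"
proof -
  have "card (monos_of (insert a F) (Suc i)) = card (monos_of F i \<union> monos_of (insert a F) i)"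
    unfolding monos_of_insert_Suc[OF assms(1)] by (intro card_image) (auto intro: inj_onI)
  also have "\<dots> = card (monos_of F i) + card (monos_of (insert a F) i)"
    using assms by (intro card_Un_disjoint finite_monos_of) (auto simp: monos_of_def)
  finally show ?thesis .
qed

text \<open>These are the compositions of i + 1 into \<open>card F\<close> positive parts. Both the
  count and the binomial coefficients satisfy Pascal's rule, so an induction on F with an inner
  induction on i identifies them.\<close>

lemma card_monos_of_Suc:
  assumes "finite F" "F \<noteq> {}"
  shows "card (monos_of F (Suc i)) = i choose (card F - 1)"
  using assms
proof (induction F arbitrary: i rule: finite_ne_induct)
  case (singleton a)
  show ?case
  proof (induction i)
    case (Suc i)
    then show ?case using card_monos_of_insert_Suc[of a "{}" "Suc i"] by (simp add: monos_of_empty)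
  qed (simp add: card_monos_of_insert_Suc monos_of_empty monos_of_0)
next
  case (insert a F)
  then obtain k where k: "card F = Suc k"
    by (cases "card F") auto
  show ?case
  proof (induction i)
    case (Suc i)
    have "card (monos_of (insert a F) (Suc (Suc i))) = (i choose k) + (i choose Suc k)"
      using card_monos_of_insert_Suc[of a F "Suc i"] insert Suc k by simp
    then show ?case using insert k by simp
  qed (use insert k in \<open>simp add: card_monos_of_insert_Suc monos_of_0\<close>)
qed

text \<open>This is (z - 1 choose k) as a polynomial in z. The shift by one reflects that degree i +
  1 contributes i choose k.\<close>

definition binomial_poly :: "nat \<Rightarrow> rat poly" where
  "binomial_poly k = Polynomial.smult (inverse (fact k)) (\<Prod>j<k. [:- (1 + of_nat j), 1:])"

lemma poly_binomial_poly: "poly (binomial_poly k) (of_nat (Suc i)) = of_nat (i choose k)"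
proof -
  have "of_nat (i choose k) = (of_nat i gchoose k :: rat)"
    by (rule binomial_gbinomial)
  also have "\<dots> = poly (binomial_poly k) (of_nat (Suc i))"
    by (simp add: gbinomial_prod_rev binomial_poly_def poly_prod divide_inverse mult.commute
        atLeast0LessThan algebra_simps)
  finally show ?thesis by simp
qed

lemma degree_binomial_poly: "Polynomial.degree (binomial_poly k) = k"
  by (simp add: binomial_poly_def degree_prod_eq_sum_degree)

lemma lead_coeff_binomial_poly: "lead_coeff (binomial_poly k) = inverse (fact k)"
  by (simp add: binomial_poly_def lead_coeff_prod)

context stanley_reisner
begin

lemma homogeneous_polys_eq:
  "homogeneous_polys n i = polys_on {m \<in> monos_on {1..n}. mono_degree m = i}"
  by (auto simp: homogeneous_polys_def carrier_poly_ring polys_on_def)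

lemma finite_monos_of_degree: "finite {m \<in> monos_on {1..n}. mono_degree m = i}"
proof -
  have "{m \<in> monos_on {1..n}. mono_degree m = i} = (\<Union>F\<in>Pow {1..n}. monos_of F i)"
    by (auto simp: monos_on_def monos_of_def)
  moreover have "finite F" if "F \<in> Pow {1..n}" for F
    using that finite_subset by blast
  ultimately show ?thesis using finite_monos_of by simp
qed

lemma hilbert_function_Suc:
  assumes "\<Delta> \<noteq> {}"
  shows "hilbert_function A (stanley_reisner_scalars n \<Delta>) (stanley_reisner_component n \<Delta>) (Suc i)
    = (\<Sum>F\<in>\<Delta> - {{}}. i choose (card F - 1))"
proof -
  let ?S = "{m \<in> monos_on {1..n}. mono_degree m = Suc i}"
  \<comment> \<open>In positive degree no monomial has empty support, so the empty face drops
    out.\<close>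
  have eq: "?S \<inter> face_monos \<Delta> = (\<Union>F\<in>\<Delta> - {{}}. monos_of F (Suc i))"
    using face_monos_subset by (auto simp: face_monos_def monos_of_def mono_degree_def)
  have "hilbert_function A (stanley_reisner_scalars n \<Delta>) (stanley_reisner_component n \<Delta>) (Suc i)
      = card (?S \<inter> face_monos \<Delta>)"
    unfolding hilbert_function_def stanley_reisner_component_def homogeneous_polys_eq
    using finite_monos_of_degree by (intro dim_proj_polys_on assms) auto
  also have "\<dots> = (\<Sum>F\<in>\<Delta> - {{}}. card (monos_of F (Suc i)))"
    unfolding eq using finite_complex finite_face
    by (intro card_UN_disjoint ballI finite_monos_of) (auto simp: monos_of_def)
  also have "\<dots> = (\<Sum>F\<in>\<Delta> - {{}}. i choose (card F - 1))"
    using finite_face by (intro sum.cong) (auto simp: card_monos_of_Suc)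
  finally show ?thesis .
qed

lemma hilbert_polynomial_eq:
  assumes "\<Delta> \<noteq> {}"
  shows "hilbert_polynomial A (stanley_reisner_scalars n \<Delta>) (stanley_reisner_component n \<Delta>)
    = (\<Sum>F\<in>\<Delta> - {{}}. binomial_poly (card F - 1))" (is "hilbert_polynomial A ?K ?gr = ?P")
  unfolding hilbert_polynomial_def
proof (rule the_equality)
  have "of_nat (hilbert_function A ?K ?gr (Suc i)) = poly ?P (of_nat (Suc i))" for i
    unfolding hilbert_function_Suc[OF assms] of_nat_sum poly_sum poly_binomial_poly ..
  \<comment> \<open>The formula can fail in degree 0, but agreement in all positive degrees
    suffices.\<close>
  then have *: "of_nat (hilbert_function A ?K ?gr i) = poly ?P (of_nat i)" if "i > 0" for i
    using that by (cases i) auto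
  then show ev: "\<forall>\<^sub>F i in sequentially. of_nat (hilbert_function A ?K ?gr i) = poly ?P (of_nat i)"
    using eventually_gt_at_top[of 0] by (rule eventually_mono[rotated])
  fix Q :: "rat poly"
  assume "\<forall>\<^sub>F i in sequentially. of_nat (hilbert_function A ?K ?gr i) = poly Q (of_nat i)"
  with ev have "\<forall>\<^sub>F i in sequentially. poly (Q - ?P) (of_nat i) = 0"
    by eventually_elim simp
  then obtain N where "\<And>i. i \<ge> N \<Longrightarrow> poly (Q - ?P) (of_nat i) = 0"
    by (auto simp: eventually_sequentially)
  \<comment> \<open>Uniqueness: the difference of two candidates has infinitely many rational
    roots.\<close>
  then have "of_nat ` {N..} \<subseteq> {x. poly (Q - ?P) x = 0}"
    by auto
  moreover have "infinite (of_nat ` {N..} :: rat set)"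
    by (simp add: finite_image_iff inj_on_def infinite_Ici)
  ultimately have "Q - ?P = 0"
    using poly_roots_finite[of "Q - ?P"] finite_subset by blast
  then show "Q = ?P" by simp
qed

text \<open>Here d is the dimension of the complex, one less than the d of the final theorem. A face
  of dimension j gives a summand of degree j, so only the top faces reach the coefficient at
  d.\<close>

lemma lead_coeff_hilbert_polynomial:
  assumes dim: "has_dimension \<Delta> (int d)"
  shows "lead_coeff (hilbert_polynomial A (stanley_reisner_scalars n \<Delta>) (stanley_reisner_component n \<Delta>))
    = of_nat (f_number \<Delta> (int d)) / fact d"
proof -
  let ?P = "\<Sum>F\<in>\<Delta> - {{}}. binomial_poly (card F - 1)"
  have ne: "\<Delta> \<noteq> {}" using dim by (auto simp: has_dimension_def)
  have le: "card F - 1 \<le> d" if "F \<in> \<Delta>" for F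
    using dim that by (auto simp: has_dimension_def face_dim_def dest!: bspec)
  have coeff: "Polynomial.coeff ?P d = of_nat (f_number \<Delta> (int d)) / fact d"
  proof -
    have "Polynomial.coeff (binomial_poly (card F - 1)) d = (if face_dim F = int d then inverse (fact d) else 0)"
      if F: "F \<in> \<Delta> - {{}}" for F
    proof -
      \<comment> \<open>For the empty face \<open>card F - 1\<close> would be 0, as for a vertex.
        Excluding it makes \<open>card F - 1 = d\<close> equivalent to having dimension d.\<close>
      have pos: "card F > 0" using F finite_face by (auto simp: card_gt_0_iff)
      show ?thesis
      proof (cases "card F - 1 = d")
        case True
        then show ?thesis using pos lead_coeff_binomial_poly[of d]
          by (auto simp: degree_binomial_poly face_dim_def)
      next
        case False
        then have "card F - 1 < d" using le F by force
        then show ?thesis using pos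
          by (auto simp: coeff_eq_0 degree_binomial_poly face_dim_def)
      qed
    qed
    then have "Polynomial.coeff ?P d = (\<Sum>F\<in>\<Delta> - {{}}. if face_dim F = int d then inverse (fact d) else 0)"
      by (simp add: coeff_sum)
    also have "\<dots> = of_nat (card {F \<in> \<Delta> - {{}}. face_dim F = int d}) * inverse (fact d)"
      using finite_complex by (simp add: sum.If_cases Int_def)
    also have "{F \<in> \<Delta> - {{}}. face_dim F = int d} = {F \<in> \<Delta>. face_dim F = int d}"
      by (auto simp: face_dim_def)
    finally show ?thesis by (simp add: f_number_def divide_inverse)
  qed
  \<comment> \<open>A face of dimension d exists, so the coefficient at d is nonzero and d is the
    exact degree.\<close>
  have "f_number \<Delta> (int d) > 0"
    using dim finite_complex by (auto simp: f_number_def has_dimension_def card_gt_0_iff)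
  then have "Polynomial.coeff ?P d \<noteq> 0" using coeff by simp
  moreover have "Polynomial.degree ?P \<le> d"
    using le finite_complex by (intro degree_sum_le) (auto simp: degree_binomial_poly)
  ultimately have "Polynomial.degree ?P = d" by (intro antisym le_degree)
  then show ?thesis using coeff hilbert_polynomial_eq[OF ne] by simp
qed

end

section \<open>Upper bound for the Krull dimension\<close>

text \<open>Gaussian elimination: X indexes the unknowns and B the equations. An unknown y occurring
  in equation b is eliminated from the others and recovered from b.\<close>

lemma underdetermined_system:
  fixes v :: "'a \<Rightarrow> 'b \<Rightarrow> 'k::field"
  assumes "finite B" "finite X" "card B < card X"
  shows "\<exists>c. (\<exists>x\<in>X. c x \<noteq> 0) \<and> (\<forall>b\<in>B. (\<Sum>x\<in>X. c x * v x b) = 0)"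
  using assms
proof (induction B arbitrary: X v rule: finite_induct)
  case empty
  then obtain x where "x \<in> X" by fastforce
  then show ?case by (intro exI[of _ "\<lambda>_. 1"]) auto
next
  case (insert b B)
  show ?case
  proof (cases "\<exists>x\<in>X. v x b \<noteq> 0")
    case False
    have "card B < card X" using insert by simp
    then obtain c where "\<exists>x\<in>X. c x \<noteq> 0" "\<forall>b\<in>B. (\<Sum>x\<in>X. c x * v x b) = 0"
      using insert.IH[OF insert.prems(1), of v] by auto
    then show ?thesis using False by (intro exI[of _ c]) simp
  next
    case True
    then obtain y where y: "y \<in> X" "v y b \<noteq> 0" by blast
    let ?X = "X - {y}"
    let ?w = "\<lambda>x b'. v x b' - v x b / v y b * v y b'"
    have "card B < card ?X" using insert y by (simp add: card_Diff_singleton)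
    then obtain c where c: "\<exists>x\<in>?X. c x \<noteq> 0" "\<forall>b'\<in>B. (\<Sum>x\<in>?X. c x * ?w x b') = 0"
      using insert.IH[of ?X ?w] insert.prems by auto
    \<comment> \<open>The value at y is solved from equation b; with it, every original equation
      takes the value of its reduced form.\<close>
    define e where "e = (\<lambda>x. if x = y then - (\<Sum>x\<in>?X. c x * v x b / v y b) else c x)"
    have sum: "(\<Sum>x\<in>X. e x * v x b') = (\<Sum>x\<in>?X. c x * ?w x b')" for b'
    proof -
      have "(\<Sum>x\<in>X. e x * v x b') = e y * v y b' + (\<Sum>x\<in>?X. e x * v x b')"
        using insert.prems(1) y(1) by (rule sum.remove)
      also have "(\<Sum>x\<in>?X. e x * v x b') = (\<Sum>x\<in>?X. c x * v x b')"
        by (rule sum.cong) (auto simp: e_def)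
      also have "e y * v y b' + (\<Sum>x\<in>?X. c x * v x b') = (\<Sum>x\<in>?X. c x * ?w x b')"
        by (simp add: e_def sum_distrib_right right_diff_distrib sum_subtractf mult.assoc)
      finally show ?thesis .
    qed
    \<comment> \<open>At the pivot equation the reduced coefficients themselves vanish.\<close>
    have "(\<Sum>x\<in>?X. c x * ?w x b) = 0" using y by simp
    moreover have "\<exists>x\<in>X. e x \<noteq> 0" using c(1) by (auto simp: e_def)
    ultimately show ?thesis using sum c(2) by (intro exI[of _ e]) auto
  qed
qed

text \<open>Pulling primes back to the polynomial ring allows the chain argument to compute with
  polynomials instead of cosets.\<close>

lemma (in ring_hom_ring) primeideal_vimage:
  assumes "cring R" "primeideal P S"
  shows "primeideal {r \<in> carrier R. h r \<in> P} R"
proof -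
  interpret P: primeideal P S by fact
  show ?thesis
  proof (rule primeidealI)
    show "ideal {r \<in> carrier R. h r \<in> P} R" by (rule ideal_vimage[OF P.is_ideal])
    show "carrier R \<noteq> {r \<in> carrier R. h r \<in> P}"
    proof
      assume "carrier R = {r \<in> carrier R. h r \<in> P}"
      then have "h \<one> \<in> P" using R.one_closed by blast
      then show False using P.I_notcarr P.one_imp_carrier by simp
    qed
    show "a \<in> {r \<in> carrier R. h r \<in> P} \<or> b \<in> {r \<in> carrier R. h r \<in> P}"
      if "a \<in> carrier R" "b \<in> carrier R" "a \<otimes> b \<in> {r \<in> carrier R. h r \<in> P}" for a b
      using that P.I_prime[of "h a" "h b"] by auto
  qed (rule assms(1))
qed

section \<open>Algebraic independence along a chain of primes\<close>

definition exponents :: "nat \<Rightarrow> nat \<Rightarrow> nat list set" where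
  "exponents N m = {as. set as \<subseteq> {..<N} \<and> length as = m}"

text \<open>Recursion on the list shifts f by one, in step with passing from the chain starting at
  \<open>P 0\<close> to the one starting at \<open>P 1\<close>.\<close>

primrec power_product :: "(nat \<Rightarrow> 'a::comm_monoid_mult) \<Rightarrow> nat list \<Rightarrow> 'a" where
  "power_product f [] = 1"
| "power_product f (a # as) = f 0 ^ a * power_product (\<lambda>i. f (Suc i)) as"

lemma exponents_0 [simp]: "exponents N 0 = {[]}"
  by (auto simp: exponents_def)

lemma sum_exponents_Suc: "sum g (exponents N (Suc m)) = (\<Sum>a<N. \<Sum>as\<in>exponents N m. g (a # as))"
proof -
  have "exponents N (Suc m) = (\<lambda>(a, as). a # as) ` ({..<N} \<times> exponents N m)"
    by (auto simp: exponents_def length_Suc_conv image_iff)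
  moreover have "inj_on (\<lambda>(a, as). a # as) ({..<N} \<times> exponents N m)"
    by (auto intro: inj_onI)
  ultimately show ?thesis
    by (simp add: sum.reindex sum.cartesian_product case_prod_unfold)
qed

lemma finite_exponents: "finite (exponents N m)"
  and card_exponents: "card (exponents N m) = N ^ m"
  using finite_lists_length_eq[of "{..<N}" m] card_lists_length_eq[of "{..<N}" m]
  by (simp_all add: exponents_def)

lemma (in primeideal) power_not_mem:
  assumes "a \<in> carrier R" "a \<notin> I"
  shows "a [^] (k::nat) \<notin> I"
proof (induction k)
  case 0
  then show ?case using I_notcarr one_imp_carrier by auto
next
  case (Suc k)
  then show ?case using assms I_prime[of "a [^] k" a] by auto
qed

lemma nat_pow_poly_ring: "p [^]\<^bsub>poly_ring n\<^esub> (k::nat) = p ^ k"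
  by (induction k) (simp_all add: mult.commute nat_pow_def)

lemma poly_ring_power_closed: "p \<in> carrier (poly_ring n) \<Longrightarrow> p ^ k \<in> carrier (poly_ring n)"
  using monoid.nat_pow_closed[OF ring.is_monoid[OF cring.axioms(1)[OF cring_poly_ring]], of p n k]
  by (simp add: nat_pow_poly_ring)

lemma poly_ring_mult_closed:
  "p \<in> carrier (poly_ring n) \<Longrightarrow> q \<in> carrier (poly_ring n) \<Longrightarrow> p * q \<in> carrier (poly_ring n)"
  by (simp add: carrier_poly_ring polys_on_monos_on_mult)

lemma poly_ring_sum_closed:
  "(\<And>x. x \<in> X \<Longrightarrow> f x \<in> carrier (poly_ring n)) \<Longrightarrow> sum f X \<in> carrier (poly_ring n)"
  by (simp add: carrier_poly_ring polys_on_sum)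

lemma power_product_closed:
  "(\<And>i. i < length as \<Longrightarrow> f i \<in> carrier (poly_ring n)) \<Longrightarrow> power_product f as \<in> carrier (poly_ring n)"
proof (induction as arbitrary: f)
  case Nil
  then show ?case by (simp add: carrier_poly_ring polys_on_def)
next
  case (Cons a as)
  then show ?case by (auto intro!: poly_ring_mult_closed poly_ring_power_closed)
qed

text \<open>
  Cancelling the smallest power of \<open>f 0\<close> from a relation modulo \<open>P 0\<close> leaves, modulo \<open>P 1\<close>, a
  relation among the remaining elements.
\<close>

lemma chain_algebraically_independent:
  fixes P :: "nat \<Rightarrow> 'k::field mpoly set"
  assumes "\<And>i. i \<le> m \<Longrightarrow> primeideal (P i) (poly_ring n)"
    and "\<And>i. i < m \<Longrightarrow> P i \<subseteq> P (Suc i)"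
    and "\<And>i. i < m \<Longrightarrow> f i \<in> P (Suc i) - P i"
    and "(\<Sum>as\<in>exponents N m. const_poly (c as) * power_product f as) \<in> P 0"
    and "as \<in> exponents N m"
  shows "c as = 0"
  using assms
proof (induction m arbitrary: P f c as)
  case 0
  interpret P: primeideal "P 0" "poly_ring n :: 'k mpoly ring" using 0 by simp
  show ?case
  proof (rule ccontr)
    assume "c as \<noteq> 0"
    \<comment> \<open>The only exponent vector of length 0 is \<open>[]\<close>, so the relation
      would put a nonzero constant, hence a unit, into \<open>P 0\<close>.\<close>
    then have "const_poly (inverse (c [])) * const_poly (c []) = 1"
      using 0 by (simp add: const_poly_simps[symmetric])
    moreover have "const_poly (inverse (c [])) * const_poly (c []) \<in> P 0"
      using 0 P.I_l_closed[of "const_poly (c [])" "const_poly (inverse (c []))"]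
      by (simp add: carrier_poly_ring const_poly_def polys_on_single)
    ultimately show False using P.I_notcarr P.one_imp_carrier by simp
  qed
next
  case (Suc m)
  let ?R = "poly_ring n :: 'k mpoly ring"
  interpret P0: primeideal "P 0" ?R using Suc by simp
  interpret P1: primeideal "P (Suc 0)" ?R using Suc by simp
  have fR: "f i \<in> carrier ?R" if "i < Suc m" for i
  proof -
    interpret P: primeideal "P (Suc i)" ?R using Suc.prems(1)[of "Suc i"] that by simp
    show ?thesis using Suc.prems(3)[OF that] P.a_subset by blast
  qed
  \<comment> \<open>\<open>G a\<close> collects the terms with first exponent a, that is, the
    coefficient of \<open>f 0 ^ a\<close>.\<close>
  define G where "G a = (\<Sum>as\<in>exponents N m. const_poly (c (a # as)) * power_product (\<lambda>i. f (Suc i)) as)" for a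
  have GR: "G a \<in> carrier ?R" for a
    unfolding G_def
  proof (intro poly_ring_sum_closed poly_ring_mult_closed power_product_closed)
    show "const_poly c \<in> carrier ?R" for c by (simp add: carrier_poly_ring const_poly_def polys_on_single)
  qed (use fR in \<open>auto simp: exponents_def\<close>)
  have "(\<Sum>as\<in>exponents N (Suc m). const_poly (c as) * power_product f as) = (\<Sum>a<N. f 0 ^ a * G a)"
    by (simp add: sum_exponents_Suc G_def sum_distrib_left mult_ac)
  then have rel: "(\<Sum>a<N. f 0 ^ a * G a) \<in> P 0" using Suc.prems(4) by simp
  have zero: "c (a # as) = 0" if "a < N" "as \<in> exponents N m" for a as
    using that
  proof (induction a arbitrary: as rule: less_induct)
    case (less a)
    have "G b = 0" if "b < a" for b
      using less.IH[OF that] that less.prems(1) by (simp add: G_def const_poly_simps)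
    \<comment> \<open>The terms before a vanish by the inner induction, and those after it sum to
      \<open>f 0 ^ a * (f 0 * H)\<close>; the extra factor \<open>f 0\<close> lies in
      \<open>P (Suc 0)\<close>.\<close>
    define H where "H = (\<Sum>b\<in>{Suc a..<N}. f 0 ^ (b - Suc a) * G b)"
    have HR: "H \<in> carrier ?R"
      unfolding H_def using fR GR
      by (intro poly_ring_sum_closed poly_ring_mult_closed poly_ring_power_closed) auto
    have "(\<Sum>b<N. f 0 ^ b * G b) = (\<Sum>b<a. f 0 ^ b * G b) + (\<Sum>b\<in>{a..<N}. f 0 ^ b * G b)"
      using less.prems(1) by (simp add: lessThan_atLeast0 sum.atLeastLessThan_concat)
    also have "(\<Sum>b<a. f 0 ^ b * G b) = 0"
      using \<open>\<And>b. b < a \<Longrightarrow> G b = 0\<close> by simp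
    also have "(\<Sum>b\<in>{a..<N}. f 0 ^ b * G b) = f 0 ^ a * G a + (\<Sum>b\<in>{Suc a..<N}. f 0 ^ b * G b)"
      using less.prems(1) by (rule sum.atLeast_Suc_lessThan)
    also have "(\<Sum>b\<in>{Suc a..<N}. f 0 ^ b * G b) = f 0 ^ a * (f 0 * H)"
      unfolding H_def sum_distrib_left
    proof (intro sum.cong refl)
      fix b assume "b \<in> {Suc a..<N}"
      then have "b = a + Suc (b - Suc a)" by simp
      then have "f 0 ^ b = f 0 ^ a * (f 0 * f 0 ^ (b - Suc a))"
        by (metis power_Suc power_add)
      then show "f 0 ^ b * G b = f 0 ^ a * (f 0 * (f 0 ^ (b - Suc a) * G b))"
        by (simp add: mult_ac)
    qed
    finally have "f 0 ^ a * (G a + f 0 * H) \<in> P 0"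
      using rel by (simp add: algebra_simps)
    moreover have "f 0 ^ a \<notin> P 0"
      using P0.power_not_mem[of "f 0" a] fR[of 0] Suc.prems(3)[of 0] by (simp add: nat_pow_poly_ring)
    moreover have "f 0 * H \<in> carrier ?R"
      using fR HR by (intro poly_ring_mult_closed) auto
    ultimately have "G a + f 0 * H \<in> P 0"
      using P0.I_prime[of "f 0 ^ a" "G a + f 0 * H"] fR GR P0.add.m_closed[of "G a" "f 0 * H"]
      by (auto intro: poly_ring_power_closed)
    then have "G a + f 0 * H \<in> P (Suc 0)" using Suc.prems(2)[of 0] by auto
    moreover have "- (f 0 * H) \<in> P (Suc 0)"
      using P1.I_r_closed[of "f 0" H] HR Suc.prems(3)[of 0] P1.a_inv_closed[of "f 0 * H"]
        \<open>f 0 * H \<in> carrier ?R\<close>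
      by (simp add: a_inv_poly_ring)
    ultimately have "G a \<in> P (Suc 0)"
      using P1.a_closed[of "G a + f 0 * H" "- (f 0 * H)"] by simp
    then show ?case
      using Suc.IH[of "\<lambda>i. P (Suc i)" "\<lambda>i. f (Suc i)" "\<lambda>as. c (a # as)" as] Suc.prems(1-3) less.prems(2)
      by (auto simp: G_def)
  qed
  obtain a as' where "as = a # as'" "a < N" "as' \<in> exponents N m"
    using Suc.prems(5) by (auto simp: exponents_def length_Suc_conv)
  then show ?case using zero by simp
qed

text \<open>Bounding each exponent rather than the total degree turns the count over a face into a
  count of functions, and such bounds still add under multiplication.\<close>

definition bounded_monos :: "nat \<Rightarrow> (nat \<Rightarrow>\<^sub>0 nat) set" where
  "bounded_monos T = {m. \<forall>i. Poly_Mapping.lookup m i \<le> T}"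

lemma zero_bounded [simp]: "0 \<in> bounded_monos T"
  by (simp add: bounded_monos_def)

lemma polys_on_bounded_mult:
  "p \<in> polys_on (bounded_monos S) \<Longrightarrow> q \<in> polys_on (bounded_monos T) \<Longrightarrow>
    p * q \<in> polys_on (bounded_monos (S + T))"
  by (erule polys_on_mult) (auto simp: bounded_monos_def lookup_add intro: add_mono)

lemma bounded_monos_mono: "S \<le> T \<Longrightarrow> polys_on (bounded_monos S) \<subseteq> polys_on (bounded_monos T)"
  unfolding polys_on_def bounded_monos_def by (auto intro: order_trans)

lemma polys_on_bounded_power:
  "p \<in> polys_on (bounded_monos S) \<Longrightarrow> p ^ k \<in> polys_on (bounded_monos (k * S))"
  by (induction k) (simp_all add: polys_on_bounded_mult one_in_polys_on)

lemma power_product_bounded: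
  assumes "\<And>i. i < m \<Longrightarrow> f i \<in> polys_on (bounded_monos D)" "as \<in> exponents N m"
  shows "power_product f as \<in> polys_on (bounded_monos (m * (N * D)))"
  using assms
proof (induction m arbitrary: f as)
  case 0
  then show ?case by (simp add: one_in_polys_on)
next
  case (Suc m)
  then obtain a as' where as: "as = a # as'" "a < N" "as' \<in> exponents N m"
    by (auto simp: exponents_def length_Suc_conv)
  have "f 0 ^ a \<in> polys_on (bounded_monos (N * D))"
    using polys_on_bounded_power[of "f 0" D a] Suc.prems(1)[of 0] as(2)
      bounded_monos_mono[of "a * D" "N * D"] by auto
  then show ?case
    using polys_on_bounded_mult Suc.IH[of "\<lambda>i. f (Suc i)", OF _ as(3)] Suc.prems(1) as by simp
qed

lemma polys_bounded: "\<exists>D. p \<in> polys_on (bounded_monos D)"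
proof -
  let ?X = "(\<lambda>m. Poly_Mapping.lookup m ` Poly_Mapping.keys m) ` Poly_Mapping.keys p"
  have "Poly_Mapping.lookup m i \<le> Max (insert 0 (\<Union>?X))" if "m \<in> Poly_Mapping.keys p" for m i
    using that by (cases "i \<in> Poly_Mapping.keys m") (auto intro!: Max_ge simp: in_keys_iff)
  then show ?thesis unfolding polys_on_def bounded_monos_def by blast
qed

lemma finite_polys_bounded: "\<exists>D. \<forall>i<m. f i \<in> polys_on (bounded_monos D)" for m :: nat
proof -
  have "\<forall>i. \<exists>D. f i \<in> polys_on (bounded_monos D)" using polys_bounded by blast
  then obtain D where D: "\<And>i. f i \<in> polys_on (bounded_monos (D i))" by metis
  have "D i \<le> Max (D ` {..<m})" if "i < m" for i using that by simp
  then show ?thesis using D bounded_monos_mono by blast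
qed

context stanley_reisner
begin

text \<open>A monomial with support F is determined by its exponents on F. Counting all functions
  from F to {0..T} is crude, but only the growth of order d in T matters.\<close>

lemma card_bounded_face_monos:
  assumes "\<And>F. F \<in> \<Delta> \<Longrightarrow> card F \<le> d"
  shows "finite (bounded_monos T \<inter> face_monos \<Delta>)"
    and "card (bounded_monos T \<inter> face_monos \<Delta>) \<le> card \<Delta> * Suc T ^ d"
proof -
  let ?M = "\<lambda>F. {m \<in> bounded_monos T. Poly_Mapping.keys m = F}"
  have eq: "bounded_monos T \<inter> face_monos \<Delta> = (\<Union>F\<in>\<Delta>. ?M F)"
    by (auto simp: face_monos_def)
  have M: "finite (?M F) \<and> card (?M F) \<le> Suc T ^ d" if F: "F \<in> \<Delta>" for F
  proof -
    let ?r = "\<lambda>m. restrict (Poly_Mapping.lookup m) F"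
    have inj: "inj_on ?r (?M F)"
    proof (rule inj_onI, rule poly_mapping_eqI)
      fix m m' i assume m: "m \<in> ?M F" "m' \<in> ?M F" "?r m = ?r m'"
      show "Poly_Mapping.lookup m i = Poly_Mapping.lookup m' i"
      proof (cases "i \<in> F")
        case True
        then show ?thesis using fun_cong[OF m(3), of i] by simp
      next
        case False
        then show ?thesis using m by (auto simp: in_keys_iff)
      qed
    qed
    have sub: "?r ` ?M F \<subseteq> PiE F (\<lambda>_. {..T})"
      by (auto simp: bounded_monos_def)
    have fin: "finite (PiE F (\<lambda>_. {..T}))"
      using finite_face[OF F] by (intro finite_PiE) auto
    have "card (?M F) \<le> card (PiE F (\<lambda>_. {..T}))"
      using inj sub fin by (rule card_inj_on_le)
    also have "\<dots> = Suc T ^ card F" using finite_face[OF F] by (simp add: card_PiE)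
    also have "\<dots> \<le> Suc T ^ d" using assms[OF F] by (intro power_increasing) auto
    finally show ?thesis using finite_imageD[OF finite_subset[OF sub fin] inj] by blast
  qed
  show "finite (bounded_monos T \<inter> face_monos \<Delta>)"
    unfolding eq using M finite_complex by blast
  have "card (\<Union>F\<in>\<Delta>. ?M F) \<le> (\<Sum>F\<in>\<Delta>. card (?M F))"
    using finite_complex by (rule card_UN_le)
  also have "\<dots> \<le> card \<Delta> * Suc T ^ d"
    using sum_bounded_above[of \<Delta> "\<lambda>F. card (?M F)" "Suc T ^ d"] M by simp
  finally show "card (bounded_monos T \<inter> face_monos \<Delta>) \<le> card \<Delta> * Suc T ^ d"
    unfolding eq .
qed

text \<open>There are N ^ (d + 1) products but only O(N ^ d) face monomials that can occur in them,
  so for large N the coefficient equations are underdetermined.\<close>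

lemma algebraically_dependent:
  fixes f :: "nat \<Rightarrow> 'k mpoly"
  assumes "\<And>F. F \<in> \<Delta> \<Longrightarrow> card F \<le> d" and f: "\<And>i. i < Suc d \<Longrightarrow> f i \<in> carrier R"
  shows "\<exists>N c. (\<exists>as\<in>exponents N (Suc d). c as \<noteq> 0) \<and>
    (\<Sum>as\<in>exponents N (Suc d). const_poly (c as) * power_product f as) \<in> I"
proof -
  obtain D where D: "\<And>i. i < Suc d \<Longrightarrow> f i \<in> polys_on (bounded_monos D)"
    using finite_polys_bounded[of "Suc d" f] by blast
  \<comment> \<open>Y is a slope with \<open>Suc ?T \<le> N * Y\<close>, since the exponent bound
    grows linearly in N. Then N is chosen to exceed the constant
    \<open>card \<Delta> * Y ^ d\<close>.\<close>
  define Y where "Y = Suc (Suc d * D)"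
  define N where "N = Suc (card \<Delta> * Y ^ d)"
  let ?X = "exponents N (Suc d)" and ?T = "Suc d * (N * D)"
  let ?B = "bounded_monos ?T \<inter> face_monos \<Delta>"
  have "N \<ge> 1" by (simp add: N_def)
  then have "Suc ?T \<le> N * Y" by (simp add: Y_def algebra_simps)
  then have "card \<Delta> * Suc ?T ^ d \<le> card \<Delta> * (N * Y) ^ d"
    by (intro mult_left_mono power_mono) auto
  also have "\<dots> = (card \<Delta> * Y ^ d) * N ^ d" by (simp add: power_mult_distrib)
  also have "\<dots> < N * N ^ d"
    by (rule mult_strict_right_mono) (simp_all add: N_def)
  finally have "card ?B < card ?X"
    using card_bounded_face_monos(2)[OF assms(1), of ?T] by (simp add: card_exponents)
  then obtain c where c: "\<exists>as\<in>?X. c as \<noteq> 0"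
    "\<forall>b\<in>?B. (\<Sum>as\<in>?X. c as * Poly_Mapping.lookup (power_product f as) b) = 0"
    using underdetermined_system[OF card_bounded_face_monos(1)[OF assms(1)] finite_exponents,
      of ?T N "Suc d" "\<lambda>as b. Poly_Mapping.lookup (power_product f as) b"] by blast
  let ?p = "\<Sum>as\<in>?X. const_poly (c as) * power_product f as"
  have "?p \<in> carrier R"
    using f by (intro poly_ring_sum_closed poly_ring_mult_closed power_product_closed const_in_carrier)
      (auto simp: exponents_def)
  \<comment> \<open>Face monomials beyond the bound do not occur in the combination; those within it
    have coefficient zero by the choice of c.\<close>
  moreover have "restrict_poly (face_monos \<Delta>) ?p = 0"
  proof (rule poly_mapping_eqI)
    fix m
    have "?p \<in> polys_on (bounded_monos ?T)"
      by (intro polys_on_sum const_mult_in_polys_on power_product_bounded D)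
    then have "Poly_Mapping.lookup ?p m = 0" if "m \<notin> bounded_monos ?T"
      using that by (auto simp: polys_on_def in_keys_iff)
    moreover have "Poly_Mapping.lookup ?p m = 0" if "m \<in> ?B"
      using c(2) that by (simp add: lookup_sum lookup_const_mult)
    ultimately show "Poly_Mapping.lookup (restrict_poly (face_monos \<Delta>) ?p) m = Poly_Mapping.lookup 0 m"
      by (auto simp: lookup_restrict_poly)
  qed
  ultimately show ?thesis using c(1) mem_I_iff by blast
qed

text \<open>In a longer chain, d + 1 elements from successive differences of the pulled-back primes
  would be independent modulo the smallest prime, yet they are dependent modulo \<open>I\<close>,
  which that prime contains.\<close>

lemma krull_dim_le:
  assumes "\<And>F. F \<in> \<Delta> \<Longrightarrow> card F \<le> d"
  shows "krull_dim A \<le> enat d"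
  unfolding krull_dim_def
proof (rule Sup_least, clarify)
  fix m P
  assume prime: "\<forall>i\<le>m. primeideal (P i) A" and chain: "\<forall>i<m. P i \<subset> P (Suc i)"
  interpret proj: ring_hom_ring R A proj by (rule proj_hom)
  define Q where "Q i = {p \<in> carrier R. proj p \<in> P i}" for i
  have "m \<le> d"
  proof (rule ccontr)
    assume "\<not> m \<le> d"
    then have m: "Suc d \<le> m" by simp
    have Q: "primeideal (Q i) R" if "i \<le> m" for i
      unfolding Q_def using proj.primeideal_vimage[OF cring_R] prime that by blast
    \<comment> \<open>Strictness survives the pullback because the projection is surjective.\<close>
    have "\<exists>p. p \<in> Q (Suc i) - Q i" if "i < m" for i
    proof -
      obtain X where X: "X \<in> P (Suc i)" "X \<notin> P i" using chain \<open>i < m\<close> by blast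
      have "P (Suc i) \<subseteq> carrier A"
        using prime \<open>i < m\<close> by (auto dest!: spec[of _ "Suc i"]
          simp: primeideal_def intro: additive_subgroup.a_Hcarr[OF ideal.axioms(1)])
      then show ?thesis using X carrier_A by (auto simp: Q_def)
    qed
    then obtain f where f: "\<And>i. i < m \<Longrightarrow> f i \<in> Q (Suc i) - Q i" by metis
    then have "f i \<in> carrier R" if "i < Suc d" for i using m that by (fastforce simp: Q_def)
    then obtain N c where c: "\<exists>as\<in>exponents N (Suc d). c as \<noteq> 0"
      "(\<Sum>as\<in>exponents N (Suc d). const_poly (c as) * power_product f as) \<in> I" (is "?p \<in> I")
      using algebraically_dependent[OF assms] by blast
    have "I \<subseteq> Q 0"
    proof
      fix p assume "p \<in> I"
      moreover from this have "p \<in> carrier R" by (auto simp: I_eq carrier_poly_ring polys_on_def)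
      moreover have "\<zero>\<^bsub>A\<^esub> \<in> P 0"
        using prime by (auto simp: primeideal_def intro: additive_subgroup.zero_closed ideal.axioms(1))
      ultimately show "p \<in> Q 0" using proj_eq_0_iff[of p] by (simp add: Q_def)
    qed
    then have "?p \<in> Q 0" using c(2) by blast
    moreover have "Q i \<subseteq> Q (Suc i)" if "i < m" for i using chain that by (auto simp: Q_def)
    ultimately show False
      using chain_algebraically_independent[of "Suc d" Q n f c N] Q f m c(1) by auto
  qed
  then show "enat m \<le> enat d" by simp
qed

end

section \<open>Krull dimension and multiplicity\<close>

context stanley_reisner
begin

text \<open>The prime ideal of \<open>A\<close> generated by the variables outside \<open>G\<close>.\<close>

definition vertex_ideal :: "nat set \<Rightarrow> 'k mpoly set set" where
  "vertex_ideal G = proj ` {p \<in> carrier R. restrict_poly (monos_on G) p = 0}"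

text \<open>A monomial in the variables of a face G is supported on a face, so it never occurs in an
  element of \<open>I\<close>. Restriction to G therefore depends only on the residue class.\<close>

lemma restrict_poly_eq_0_of_mem_I:
  assumes "G \<in> \<Delta>" "p \<in> I"
  shows "restrict_poly (monos_on G) p = 0"
  using assms subset_faces
  by (auto simp: restrict_poly_eq_0_iff I_eq polys_on_def monos_on_def face_monos_def)

lemma proj_mem_vertex_ideal_iff:
  assumes "G \<in> \<Delta>" "p \<in> carrier R"
  shows "proj p \<in> vertex_ideal G \<longleftrightarrow> restrict_poly (monos_on G) p = 0"
proof
  assume "proj p \<in> vertex_ideal G"
  then obtain q where q: "q \<in> carrier R" "restrict_poly (monos_on G) q = 0" "proj p = proj q"
    by (auto simp: vertex_ideal_def)
  then have "restrict_poly (monos_on G) (p - q) = 0"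
    using restrict_poly_eq_0_of_mem_I assms proj_eq_iff by blast
  then show "restrict_poly (monos_on G) p = 0"
    using restrict_poly_add[of "monos_on G" "p - q" q] q(2) by simp
qed (use assms in \<open>auto simp: vertex_ideal_def\<close>)

lemma primeideal_vertex_ideal:
  assumes "G \<in> \<Delta>"
  shows "primeideal (vertex_ideal G) A"
proof -
  interpret R: cring R by (rule cring_R)
  interpret proj: ring_hom_ring R A proj by (rule proj_hom)
  let ?Q = "{p \<in> carrier R. restrict_poly (monos_on G) p = 0}"
  have "ideal ?Q R"
  proof (rule idealI)
    show "subgroup ?Q (add_monoid R)"
    proof (rule R.add.subgroupI)
      show "?Q \<noteq> {}"
        using R.zero_closed by (auto simp: restrict_poly_eq_0_iff intro!: exI[of _ 0])
      show "\<ominus>\<^bsub>R\<^esub> p \<in> ?Q" if "p \<in> ?Q" for p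
        using that R.a_inv_closed[of p]
        by (simp add: a_inv_poly_ring restrict_poly_eq_0_iff polys_on_uminus)
      show "p \<oplus>\<^bsub>R\<^esub> q \<in> ?Q" if "p \<in> ?Q" "q \<in> ?Q" for p q
        using that R.a_closed[of p q] by (simp add: restrict_poly_add)
    qed auto
  qed (use R.ring_axioms in \<open>auto simp: restrict_poly_mult poly_ring_mult_closed\<close>)
  then have ideal: "ideal (vertex_ideal G) A"
    unfolding vertex_ideal_def stanley_reisner_ring_def
    by (rule R.ring_ideal_imp_quot_ideal[OF ideal_I])
  show ?thesis
  proof (rule primeidealI[OF ideal cring_A])
    have "restrict_poly (monos_on G) 1 = (1 :: 'k mpoly)"
      by (intro restrict_poly_id one_in_polys_on) simp
    then have "proj 1 \<notin> vertex_ideal G"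
      using proj_mem_vertex_ideal_iff[OF assms, of 1] R.one_closed by simp
    then show "carrier A \<noteq> vertex_ideal G"
      using R.one_closed carrier_A by auto
    fix X Y assume XY: "X \<in> carrier A" "Y \<in> carrier A" "X \<otimes>\<^bsub>A\<^esub> Y \<in> vertex_ideal G"
    then obtain p q where pq: "p \<in> carrier R" "q \<in> carrier R" "X = proj p" "Y = proj q"
      by (auto simp: carrier_A)
    then have "proj (p * q) \<in> vertex_ideal G"
      using XY(3) proj.hom_mult[of p q] by simp
    \<comment> \<open>Restriction is multiplicative and polynomials have no zero divisors, so one of
      the two restrictions vanishes.\<close>
    then have "restrict_poly (monos_on G) p * restrict_poly (monos_on G) q = 0"
      using proj_mem_vertex_ideal_iff[OF assms] pq by (simp add: poly_ring_mult_closed restrict_poly_mult)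
    then show "X \<in> vertex_ideal G \<or> Y \<in> vertex_ideal G"
      using pq proj_mem_vertex_ideal_iff[OF assms] by simp
  qed
qed

lemma vertex_ideal_strict_antimono:
  assumes "G \<in> \<Delta>" "G' \<subset> G"
  shows "vertex_ideal G \<subset> vertex_ideal G'"
proof -
  have G': "G' \<in> \<Delta>" using assms subset_faces by blast
  have "vertex_ideal G \<subseteq> vertex_ideal G'"
    unfolding vertex_ideal_def using assms(2)
    by (intro image_mono) (auto simp: restrict_poly_eq_0_iff polys_on_def monos_on_def)
  moreover obtain x where x: "x \<in> G" "x \<notin> G'" using assms(2) by blast
  let ?p = "var x :: 'k mpoly"
  have "?p \<in> carrier R"
    using x(1) faces_subset[OF assms(1)] by (auto simp: carrier_poly_ring var_def polys_on_def monos_on_def)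
  moreover have "restrict_poly (monos_on G') ?p = 0" "restrict_poly (monos_on G) ?p \<noteq> 0"
    using x by (auto simp: restrict_poly_eq_0_iff polys_on_def monos_on_def var_def)
  ultimately show ?thesis
    using proj_mem_vertex_ideal_iff[OF G', of ?p] proj_mem_vertex_ideal_iff[OF assms(1), of ?p] by blast
qed

lemma krull_dim_ge:
  assumes F: "F \<in> \<Delta>"
  shows "enat (card F) \<le> krull_dim A"
proof -
  obtain e where e: "bij_betw e {0..<card F} F"
    using ex_bij_betw_nat_finite finite_face[OF F] by blast
  \<comment> \<open>Smaller faces give larger primes: the chain starts with all of F and drops one
    vertex at a time down to the empty face, which takes \<open>card F\<close> steps.\<close>
  define G where "G j = e ` {j..<card F}" for j
  have G: "G j \<in> \<Delta>" for j
  proof -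
    have "G j \<subseteq> F" using e by (auto simp: G_def bij_betw_def)
    then show ?thesis using F subset_faces by blast
  qed
  have "G (Suc j) \<subset> G j" if "j < card F" for j
  proof -
    have "{j..<card F} = insert j {Suc j..<card F}" using that by auto
    then have "G j = insert (e j) (G (Suc j))" by (simp add: G_def)
    moreover have "e j \<notin> G (Suc j)"
      using that inj_onD[OF bij_betw_imp_inj_on[OF e], of j] by (force simp: G_def)
    ultimately show ?thesis by blast
  qed
  then have "\<exists>P. (\<forall>i\<le>card F. primeideal (P i) A) \<and> (\<forall>i<card F. P i \<subset> P (Suc i))"
    using G primeideal_vertex_ideal vertex_ideal_strict_antimono
    by (intro exI[of _ "\<lambda>j. vertex_ideal (G j)"]) auto
  then show ?thesis unfolding krull_dim_def by (intro Sup_upper) blast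
qed

lemma krull_dim_stanley_reisner_ring:
  assumes "has_dimension \<Delta> (int d - 1)"
  shows "krull_dim A = enat d"
proof (rule antisym)
  show "krull_dim A \<le> enat d"
    using assms by (intro krull_dim_le) (auto simp: has_dimension_def face_dim_def)
  obtain F where "F \<in> \<Delta>" "card F = d"
    using assms by (auto simp: has_dimension_def face_dim_def)
  then show "enat d \<le> krull_dim A" using krull_dim_ge by blast
qed

end

theorem corollary3p2:
  fixes n d :: nat and \<Delta> :: "nat set set"
  assumes "simplicial_complex n \<Delta>"
    and "has_dimension \<Delta> (int d - 1)"
  shows "hilbert_samuel_multiplicity
           (stanley_reisner_ring n \<Delta> :: 'k::field mpoly set ring)
           (stanley_reisner_scalars n \<Delta>)
           (stanley_reisner_component n \<Delta>)
         = of_nat (f_number \<Delta> (int d - 1))"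
proof -
  interpret stanley_reisner n \<Delta> "TYPE('k)"
    using assms(1) by unfold_locales
  note krull = krull_dim_stanley_reisner_ring[OF assms(2)]
  show ?thesis
  proof (cases d)
    \<comment> \<open>A complex of dimension -1 has only the empty face, which forces n = 0. The
      ring is then k, and the multiplicity is its length 1.\<close>
    case 0
    then have faces: "F = {}" if "F \<in> \<Delta>" for F
      using assms(2) finite_face that by (auto simp: has_dimension_def face_dim_def dest!: bspec)
    moreover have "{i} \<in> \<Delta>" if "i \<in> {1..n}" for i
      using assms(1) that by (auto simp: simplicial_complex_def)
    ultimately have "{1..n} = {}" by blast
    then have "n = 0" by simp
    then have monos_eq: "monos_on {1..n} = {0}" by (auto simp: monos_on_def)
    then have carrier: "carrier A = proj ` polys_on {0}"
      by (simp only: carrier_A carrier_poly_ring)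
    have ne: "\<Delta> \<noteq> {}" using assms(2) by (auto simp: has_dimension_def)
    then have \<Delta>: "\<Delta> = {{}}" using faces by blast
    have "ring.dim A (stanley_reisner_scalars n \<Delta>) (carrier A) = card ({0} \<inter> face_monos \<Delta>)"
      unfolding carrier using monos_eq by (intro dim_proj_polys_on ne) auto
    moreover have "{F \<in> \<Delta>. face_dim F = int d - 1} = {{}}"
      using \<Delta> 0 by (auto simp: face_dim_def)
    ultimately show ?thesis
      using krull 0 \<Delta>
      by (simp add: hilbert_samuel_multiplicity_def f_number_def face_monos_def zero_enat_def)
  next
    \<comment> \<open>The Krull dimension minus one is e, so the normalizing factorial cancels the
      denominator of the leading coefficient.\<close>
    case (Suc e)
    then have "has_dimension \<Delta> (int e)" using assms(2) by simp
    from lead_coeff_hilbert_polynomial[OF this] show ?thesis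
      using krull Suc by (simp add: hilbert_samuel_multiplicity_def zero_enat_def)
  qed
qed

end
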